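(* Let $\alpha>0$ be fixed and let $(\Theta,d)$ be compact. Suppose the following conditions hold. 1. The target parameter $\theta_0=\arg\max_{\theta\in\Theta}M(\theta)$ exists and is unique. 2. For $\theta\in\Theta_G$, the map $\theta\mapsto m(x,\theta)$ is upper semicontinuous for a.e. $x$. 3. For all sufficiently small balls $B\subset\Theta$, the map $x\mapsto\sup_{\theta\in B}m(x,\theta)$ is measurable and satisfies $$\int_{\mathcal X}\sup_{\theta\in B}m(x,\theta)\,g(x)\,dx<\infty.$$ Then any sequence of MDPDEs $\hat\theta_{\alpha,n}$ (estimators with values in $\Theta$ based on $X_1,\dots,X_n$) that satisfies $m_n(\hat\theta_{\alpha,n})\ge m_n(\theta_0)-o_p(1)$ is such that for any $\epsilon>0$ and every compact set $K\subset\Theta$, $$P\bigl(d(\hat\theta_{\alpha,n},\theta_0)\ge\epsilon,\ \hat\theta_{\alpha,n}\in K\bigr)\to0\quad\text{as } n\to\infty.$$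
   Context: $G$ is a probability distribution with support $\mathcal X$ and density $g$; $X_1,X_2,\dots$ are i.i.d. from $G$. $\{f(x;\theta):\theta\in\Theta\}$, $x\in\mathcal X$, $\Theta\subseteq\mathbb R^p$, $p\ge1$, is a parametric family of probability densities on $\mathcal X$, identifiable in the sense that $f(x;\theta_1)=f(x;\theta_2)$ for a.e. $x$ implies $\theta_1=\theta_2$; $g$ need not belong to the family. $\Theta$ is endowed with a metric $d$ such that $(\Theta,d)$ is compact. For the fixed $\alpha>0$ define $m:\mathcal X\times\Theta\to\mathbb R$ (real-valued) by $$m(x,\theta)=\Bigl(1+\tfrac1\alpha\Bigr)f^\alpha(x;\theta)-\int_{\mathcal X}f^{1+\alpha}(y;\theta)\,dy,\qquad m_n(\theta)=\frac1n\sum_{i=1}^n m(X_i,\theta).$$ Let $\Theta_G=\{\theta\in\Theta:\int_{\mathcal X}|m(x,\theta)|g(x)\,dx<\infty\}$ (assumed to contain points other than $\theta_0$), let $M(\theta)=\int_{\mathcal X}m(x,\theta)g(x)\,dx=(1+\frac1\alpha)\int_{\mathcal X}f^\alpha(x;\theta)g(x)\,dx-\int_{\mathcal X}f^{1+\alpha}(x;\theta)\,dx$ for $\theta\in\Theta_G$, and $M(\theta)=-\infty$ for $\theta\in\Theta\setminus\Theta_G$. The target parameter $\theta_0$ satisfies $-\infty<M(\theta_0)=\sup_{\theta\in\Theta}M(\theta)<\infty$. A minimum density power divergence estimator (MDPDE) is an estimator of $\theta_0$ obtained by maximizing $m_n$ over $\Theta$; in this statement only the approximate-maximization requirement $m_n(\hat\theta_{\alpha,n})\ge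 m_n(\theta_0)-o_p(1)$ is imposed. $o_p(1)$ denotes a sequence of random variables converging to $0$ in probability. *)

theory Defs
  imports "HOL-Probability.Probability"
begin

text \<open>
  Lebesgue measure \<open>dx\<close> on the sample space. The measurable sets are the Borel subsets of \<open>\<X>\<close>.
\<close>

definition lborel_on :: "'x::euclidean_space set \<Rightarrow> 'x measure" where
  "lborel_on \<X> = restrict_space lborel \<X>"

definition prob_density_on :: "'x::euclidean_space set \<Rightarrow> ('x \<Rightarrow> real) \<Rightarrow> bool" where
  "prob_density_on \<X> h \<longleftrightarrow>
     h \<in> borel_measurable (lborel_on \<X>) \<and> (\<forall>x\<in>\<X>. 0 \<le> h x) \<and>
     (\<integral>\<^sup>+x. ennreal (h x) \<partial>lborel_on \<X>) = 1"

definition distribution_of :: "'x::euclidean_space set \<Rightarrow> ('x \<Rightarrow> real) \<Rightarrow> 'x measure" where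
  "distribution_of \<X> g = density (lborel_on \<X>) (\<lambda>x. ennreal (g x))"

text \<open>
  A distribution with density \<open>g\<close> on \<open>\<X>\<close> already has all its mass in \<open>\<X>\<close>. In addition, no relatively
  open part of \<open>\<X>\<close> of positive Lebesgue measure may be null. This holds both when the support is the
  topological support and when it is the set \<open>{x. g x > 0}\<close>, so either reading is covered, as are
  supports that are not closed, such as \<open>{0<..}\<close>.
\<close>

definition has_support :: "('x::euclidean_space \<Rightarrow> real) \<Rightarrow> 'x set \<Rightarrow> bool" where
  "has_support g \<X> \<longleftrightarrow>
     (\<forall>U. open U \<and> 0 < emeasure lborel (U \<inter> \<X>) \<longrightarrow> 0 < emeasure (distribution_of \<X> g) (U \<inter> \<X>))"

definition identifiable ::
  "'x::euclidean_space set \<Rightarrow> 'p set \<Rightarrow> ('x \<Rightarrow> 'p \<Rightarrow> real) \<Rightarrow> bool" where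
  "identifiable \<X> \<Theta> f \<longleftrightarrow>
     (\<forall>\<theta>1\<in>\<Theta>. \<forall>\<theta>2\<in>\<Theta>. (AE x in lborel_on \<X>. f x \<theta>1 = f x \<theta>2) \<longrightarrow> \<theta>1 = \<theta>2)"

text \<open>
  The Bochner integral is \<open>0\<close> for a non-integrable function, so \<open>dpd_m\<close> has the intended meaning only
  at parameters for which \<open>(f x \<theta>) powr (1 + \<alpha>)\<close> is integrable in \<open>x\<close>. This is exactly the requirement
  that \<open>m\<close> be real-valued, and it has to be assumed separately.
\<close>

definition dpd_m ::
  "real \<Rightarrow> 'x::euclidean_space set \<Rightarrow> ('x \<Rightarrow> 'p \<Rightarrow> real) \<Rightarrow> 'x \<Rightarrow> 'p \<Rightarrow> real" where
  "dpd_m \<alpha> \<X> f x \<theta> =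
     (1 + 1 / \<alpha>) * f x \<theta> powr \<alpha> - (\<integral>y. f y \<theta> powr (1 + \<alpha>) \<partial>lborel_on \<X>)"

definition dpd_mn ::
  "real \<Rightarrow> 'x::euclidean_space set \<Rightarrow> ('x \<Rightarrow> 'p \<Rightarrow> real) \<Rightarrow> (nat \<Rightarrow> 'w \<Rightarrow> 'x) \<Rightarrow> nat \<Rightarrow> 'p \<Rightarrow> 'w \<Rightarrow> real" where
  "dpd_mn \<alpha> \<X> f X n \<theta> \<omega> = (1 / real n) * (\<Sum>i=1..n. dpd_m \<alpha> \<X> f (X i \<omega>) \<theta>)"

definition Theta_G ::
  "real \<Rightarrow> 'x::euclidean_space set \<Rightarrow> 'p set \<Rightarrow> ('x \<Rightarrow> 'p \<Rightarrow> real) \<Rightarrow> ('x \<Rightarrow> real) \<Rightarrow> 'p set" where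
  "Theta_G \<alpha> \<X> \<Theta> f g =
     {\<theta>\<in>\<Theta>. (\<integral>\<^sup>+x. ennreal (\<bar>dpd_m \<alpha> \<X> f x \<theta>\<bar> * g x) \<partial>lborel_on \<X>) < \<infinity>}"

definition dpd_M ::
  "real \<Rightarrow> 'x::euclidean_space set \<Rightarrow> 'p set \<Rightarrow> ('x \<Rightarrow> 'p \<Rightarrow> real) \<Rightarrow> ('x \<Rightarrow> real) \<Rightarrow> 'p \<Rightarrow> ereal" where
  "dpd_M \<alpha> \<X> \<Theta> f g \<theta> =
     (if \<theta> \<in> Theta_G \<alpha> \<X> \<Theta> f g
      then ereal (\<integral>x. dpd_m \<alpha> \<X> f x \<theta> * g x \<partial>lborel_on \<X>) else -\<infinity>)"

definition usc_at :: "'p topology \<Rightarrow> ('p \<Rightarrow> real) \<Rightarrow> 'p \<Rightarrow> bool" where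
  "usc_at T h \<theta> \<longleftrightarrow>
     (\<forall>c>h \<theta>. \<exists>U. openin T U \<and> \<theta> \<in> U \<and> (\<forall>\<theta>'\<in>U. h \<theta>' < c))"

text \<open>
  A supremum over a ball need not be finite at every \<open>x\<close>, so it is taken in \<open>ereal\<close>. Its integral is
  the integral of the positive part minus that of the negative part (\<open>e2ennreal\<close> sends negative
  values to \<open>0\<close>). If both parts are infinite, the value is \<open>\<infinity> - \<infinity> = \<infinity>\<close>, so an integral that is
  \<open>< \<infinity>\<close> is a genuine one.
\<close>

definition ereal_integral :: "'x measure \<Rightarrow> ('x \<Rightarrow> ereal) \<Rightarrow> ereal" where
  "ereal_integral \<mu> h =
     enn2ereal (\<integral>\<^sup>+x. e2ennreal (h x) \<partial>\<mu>) - enn2ereal (\<integral>\<^sup>+x. e2ennreal (- h x) \<partial>\<mu>)"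

definition borel_of_metric :: "'p set \<Rightarrow> ('p \<Rightarrow> 'p \<Rightarrow> real) \<Rightarrow> 'p measure" where
  "borel_of_metric \<Theta> d = sigma \<Theta> {U. openin (Metric_space.mtopology \<Theta> d) U}"

definition iid_from :: "'w measure \<Rightarrow> 'x measure \<Rightarrow> (nat \<Rightarrow> 'w \<Rightarrow> 'x) \<Rightarrow> bool" where
  "iid_from P G X \<longleftrightarrow>
     prob_space.indep_vars P (\<lambda>_. G) X {1..} \<and> (\<forall>i\<ge>1. distr P G (X i) = G)"

definition estimator_based_on ::
  "'w measure \<Rightarrow> 'x measure \<Rightarrow> 'p measure \<Rightarrow> (nat \<Rightarrow> 'w \<Rightarrow> 'x) \<Rightarrow> nat \<Rightarrow> ('w \<Rightarrow> 'p) \<Rightarrow> bool" where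
  "estimator_based_on P G N X n \<theta>hat \<longleftrightarrow>
     (\<exists>T \<in> measurable (PiM {1..n} (\<lambda>_. G)) N.
        \<forall>\<omega>\<in>space P. \<theta>hat \<omega> = T (\<lambda>i\<in>{1..n}. X i \<omega>))"

definition little_op_1 :: "'w measure \<Rightarrow> (nat \<Rightarrow> 'w \<Rightarrow> real) \<Rightarrow> bool" where
  "little_op_1 P R \<longleftrightarrow>
     (\<forall>n. R n \<in> borel_measurable P) \<and>
     (\<forall>\<epsilon>>0. (\<lambda>n. measure P {\<omega>\<in>space P. \<epsilon> < \<bar>R n \<omega>\<bar>}) \<longlonglongrightarrow> 0)"

end

theory Submission
  imports Defs "HOL-Real_Asymp.Real_Asymp"
begin

text \<open>
  The argument is Wald's proof of consistency. Write \<open>m\<close> for the criterion and \<open>G\<close> for the law of an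
  observation. Around each parameter \<open>\<theta> \<noteq> \<theta>0\<close> there is a ball on which \<open>m\<close> lies, almost surely,
  below a function \<open>u\<close> of the observation alone whose mean is still smaller than the mean of \<open>m \<cdot> \<theta>0\<close>: as the ball
  shrinks to \<open>\<theta>\<close>, upper semicontinuity makes the supremum of \<open>m\<close> over it decrease to \<open>m \<cdot> \<theta>\<close>, and
  dominated convergence carries this over to the means (\<open>ball_majorant_integral_less\<close>). An approximate
  maximizer inside that ball forces the sample mean of \<open>u - m \<cdot> \<theta>0\<close> to be at least \<open>- o\<^sub>p(1)\<close>,
  although its expectation is negative; by the weak law of large numbers this is increasingly
  improbable (\<open>sample_mean_nonneg_improbable\<close>). Finitely many such balls cover the compact set of
  points of \<open>K\<close> at distance at least \<open>\<epsilon>\<close> from \<open>\<theta>0\<close> (\<open>approx_maximizer_avoids_compact\<close>).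

  Upper semicontinuity is assumed only on \<open>\<Theta>\<^sub>G\<close>, but \<open>\<Theta>\<^sub>G\<close> is all of \<open>\<Theta>\<close>: the criterion \<open>m \<cdot> \<theta>\<close> is
  bounded below by the constant \<open>- \<integral>f\<^sup>1\<^sup>+\<^sup>\<alpha>\<close> and above by its supremum over a ball, whose positive
  part has a finite integral (\<open>integrable_between_const_and_majorant\<close>). In particular \<open>M\<close> is finite
  everywhere, and the unique maximizer \<open>\<theta>0\<close> strictly beats every other parameter in terms of genuine
  integrals.

  The weak law is needed for variables that are merely integrable. It is obtained by truncation:
  Hoeffding's inequality controls the truncated variables, Markov's inequality the error.
\<close>

section \<open>The weak law of large numbers\<close>

text \<open>
  The variables are truncated at a level \<open>k\<close> chosen, independently of \<open>n\<close>, so large that the mean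
  truncation error \<open>\<rho> k\<close> is small. A deviation of the sample mean by \<open>\<epsilon>\<close> then needs either a
  deviation by \<open>\<epsilon> / 3\<close> in the truncated means, which is exponentially improbable in \<open>n\<close>, or an average
  truncation error of at least \<open>\<epsilon> / 3\<close>; the shift \<open>\<rho> k\<close> of the expectation uses up the last third.
\<close>

lemma (in prob_space) weak_law_of_large_numbers:
  fixes Y :: "nat \<Rightarrow> 'a \<Rightarrow> real"
  assumes indep: "indep_vars (\<lambda>_. borel) Y {1..}"
    and distr: "\<And>i. 1 \<le> i \<Longrightarrow> distr M borel (Y i) = distr M borel (Y 1)"
    and int: "integrable M (Y 1)"
    and \<epsilon>: "0 < \<epsilon>"
  shows "(\<lambda>n. prob {x\<in>space M. \<epsilon> \<le> \<bar>(\<Sum>i=1..n. Y i x) / real n - expectation (Y 1)\<bar>}) \<longlonglongrightarrow> 0"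
proof -
  have rv [measurable]: "Y i \<in> borel_measurable M" if "1 \<le> i" for i
    using indep that unfolding indep_vars_def by auto
  note rv1 [measurable] = rv[OF order.refl]
  define T :: "nat \<Rightarrow> real \<Rightarrow> real" where "T k y = max (- real k) (min (real k) y)" for k y
  have T_meas [measurable]: "T k \<in> borel_measurable borel" for k
    unfolding T_def by measurable
  have T_bound: "\<bar>T k y\<bar> \<le> real k" and T_err: "\<bar>y - T k y\<bar> \<le> \<bar>y\<bar>" for k y
    unfolding T_def by auto
  have int_TY: "integrable M (\<lambda>x. T k (Y 1 x))" for k
    by (rule integrable_const_bound[where B = "real k"]) (use T_bound in auto)
  define \<rho> where "\<rho> k = expectation (\<lambda>x. \<bar>Y 1 x - T k (Y 1 x)\<bar>)" for k
  have "\<rho> \<longlonglongrightarrow> expectation (\<lambda>x. 0)"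
    unfolding \<rho>_def
  proof (rule integral_dominated_convergence[where w = "\<lambda>x. \<bar>Y 1 x\<bar>"])
    show "AE x in M. (\<lambda>k. \<bar>Y 1 x - T k (Y 1 x)\<bar>) \<longlonglongrightarrow> 0"
    proof (rule AE_I2, rule tendsto_eventually)
      fix x
      show "\<forall>\<^sub>F k in sequentially. \<bar>Y 1 x - T k (Y 1 x)\<bar> = 0"
        using eventually_ge_at_top[of "nat \<lceil>\<bar>Y 1 x\<bar>\<rceil>"]
        by eventually_elim (auto simp: T_def)
    qed
  qed (use int T_err in auto)
  then have \<rho>_lim: "\<rho> \<longlonglongrightarrow> 0" by simp
  define hb where "hb k n = 2 * exp (- 2 * real n * (\<epsilon>/3)\<^sup>2 / (2 * real k)\<^sup>2)" for k n :: nat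
  have bound: "prob {x\<in>space M. \<epsilon> \<le> \<bar>(\<Sum>i=1..n. Y i x) / real n - expectation (Y 1)\<bar>}
                 \<le> hb k n + 3 / \<epsilon> * \<rho> k"
    if n: "1 \<le> n" and k: "1 \<le> k" and small: "\<rho> k < \<epsilon> / 3" for n k
  proof -
    define S where "S x = (\<Sum>i=1..n. T k (Y i x)) / real n" for x
    define E where "E x = (\<Sum>i=1..n. \<bar>Y i x - T k (Y i x)\<bar>) / real n" for x
    have [measurable]: "S \<in> borel_measurable M" "E \<in> borel_measurable M"
      unfolding S_def E_def by measurable
    have err: "integrable M (\<lambda>x. \<bar>Y i x - T k (Y i x)\<bar>)"
      "expectation (\<lambda>x. \<bar>Y i x - T k (Y i x)\<bar>) = \<rho> k" if "1 \<le> i" for i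
    proof -
      have "integrable (distr M borel (Y 1)) (\<lambda>y. \<bar>y - T k y\<bar>)"
        by (subst integrable_distr_eq) (use int int_TY in auto)
      then show "integrable M (\<lambda>x. \<bar>Y i x - T k (Y i x)\<bar>)"
        using integrable_distr_eq[of "Y i" M borel "\<lambda>y. \<bar>y - T k y\<bar>"] distr[OF that] that by simp
      show "expectation (\<lambda>x. \<bar>Y i x - T k (Y i x)\<bar>) = \<rho> k"
        using integral_distr[of "Y i" M borel "\<lambda>y. \<bar>y - T k y\<bar>"] that
          integral_distr[of "Y 1" M borel "\<lambda>y. \<bar>y - T k y\<bar>"] distr[OF that] by (simp add: \<rho>_def)
    qed
    have intE: "integrable M E"
      unfolding E_def by (intro integrable_divide_zero Bochner_Integration.integrable_sum) (use err in auto)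
    have expE: "expectation E = \<rho> k"
      unfolding E_def using n err by simp
    have hoeff: "prob {x\<in>space M. \<epsilon> / 3 \<le> \<bar>S x - expectation (\<lambda>x. T k (Y 1 x))\<bar>} \<le> hb k n"
    proof -
      interpret H: Hoeffding_ineq_iid M "{1..n}" "\<lambda>i x. T k (Y i x)" "\<lambda>x. T k (Y 1 x)"
        "- real k" "real k" "expectation (\<lambda>x. T k (Y 1 x))"
      proof unfold_locales
        show "indep_vars (\<lambda>_. borel) (\<lambda>i x. T k (Y i x)) {1..n}"
          by (rule indep_vars_compose2[OF indep_vars_subset[OF indep]]) auto
        show "distr M borel (\<lambda>x. T k (Y i x)) = distr M borel (\<lambda>x. T k (Y 1 x))"
          if "i \<in> {1..n}" for i
          using distr_distr[of "T k" borel borel "Y i" M] distr_distr[of "T k" borel borel "Y 1" M]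
            distr[of i] that by (simp add: o_def)
        show "AE x in M. T k (Y 1 x) \<in> {- real k..real k}"
          by (simp add: T_def)
      qed auto
      \<comment> \<open>For \<open>i = 1\<close> the two sides of this rewrite rule coincide, so the simplifier would loop.\<close>
      note [simp del] = H.expectation_X
      have "(2 * real k)\<^sup>2 = (real k - - real k)\<^sup>2" "real (card {1..n}) = real n" by simp_all
      then show ?thesis
        unfolding S_def hb_def using H.Hoeffding_ineq_abs_ge'[of "\<epsilon>/3"] \<epsilon> n k by simp
    qed
    have E_nonneg: "0 \<le> E x" for x
      unfolding E_def by (simp add: sum_nonneg)
    have markov: "prob {x\<in>space M. \<epsilon> / 3 \<le> E x} \<le> 3 / \<epsilon> * \<rho> k"
      using integral_Markov_inequality_measure[OF intE sets.empty_sets, of "\<epsilon>/3"] \<epsilon> expE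
      by (simp add: E_nonneg mult.commute)
    have sub: "{x\<in>space M. \<epsilon> \<le> \<bar>(\<Sum>i=1..n. Y i x) / real n - expectation (Y 1)\<bar>}
        \<subseteq> {x\<in>space M. \<epsilon> / 3 \<le> \<bar>S x - expectation (\<lambda>x. T k (Y 1 x))\<bar>} \<union> {x\<in>space M. \<epsilon> / 3 \<le> E x}"
    proof (intro subsetI, rule ccontr)
      fix x
      assume x: "x \<in> {x\<in>space M. \<epsilon> \<le> \<bar>(\<Sum>i=1..n. Y i x) / real n - expectation (Y 1)\<bar>}"
        and "x \<notin> {x\<in>space M. \<epsilon> / 3 \<le> \<bar>S x - expectation (\<lambda>x. T k (Y 1 x))\<bar>}
                    \<union> {x\<in>space M. \<epsilon> / 3 \<le> E x}"
      then have lt: "\<bar>S x - expectation (\<lambda>x. T k (Y 1 x))\<bar> < \<epsilon> / 3" "E x < \<epsilon> / 3" by auto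
      have "\<bar>(\<Sum>i=1..n. Y i x) / real n - S x\<bar> = \<bar>\<Sum>i=1..n. Y i x - T k (Y i x)\<bar> / real n"
        unfolding S_def by (simp add: sum_subtractf diff_divide_distrib[symmetric])
      also have "\<dots> \<le> E x"
        unfolding E_def by (intro divide_right_mono sum_abs) simp
      finally have 1: "\<bar>(\<Sum>i=1..n. Y i x) / real n - S x\<bar> \<le> E x" .
      have "\<bar>expectation (\<lambda>x. Y 1 x - T k (Y 1 x))\<bar> \<le> \<rho> k"
        unfolding \<rho>_def by (rule integral_abs_bound)
      then have 2: "\<bar>expectation (Y 1) - expectation (\<lambda>x. T k (Y 1 x))\<bar> \<le> \<rho> k"
        using int int_TY by simp
      have "\<epsilon> \<le> \<bar>(\<Sum>i=1..n. Y i x) / real n - expectation (Y 1)\<bar>" using x by simp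
      then show False using 1 2 lt small by linarith
    qed
    have "prob {x\<in>space M. \<epsilon> \<le> \<bar>(\<Sum>i=1..n. Y i x) / real n - expectation (Y 1)\<bar>}
       \<le> prob ({x\<in>space M. \<epsilon> / 3 \<le> \<bar>S x - expectation (\<lambda>x. T k (Y 1 x))\<bar>} \<union> {x\<in>space M. \<epsilon> / 3 \<le> E x})"
      by (intro finite_measure_mono sub) measurable
    also have "\<dots> \<le> prob {x\<in>space M. \<epsilon> / 3 \<le> \<bar>S x - expectation (\<lambda>x. T k (Y 1 x))\<bar>}
        + prob {x\<in>space M. \<epsilon> / 3 \<le> E x}"
      by (intro measure_Un_le) measurable
    finally show ?thesis using hoeff markov by linarith
  qed
  show ?thesis
  proof (rule LIMSEQ_I)
    fix \<eta> :: real assume \<eta>: "0 < \<eta>"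
    \<comment> \<open>The second bound turns the Markov term \<open>3 / \<epsilon> * \<rho> k\<close> into less than \<open>\<eta> / 2\<close>.\<close>
    have "\<forall>\<^sub>F k in sequentially. \<rho> k < min (\<epsilon> / 3) (\<epsilon> * \<eta> / 6) \<and> 1 \<le> k"
      using order_tendstoD(2)[OF \<rho>_lim, of "min (\<epsilon> / 3) (\<epsilon> * \<eta> / 6)"] \<epsilon> \<eta>
      by (intro eventually_conj eventually_ge_at_top) auto
    then obtain k where k: "\<rho> k < \<epsilon> / 3" "\<rho> k < \<epsilon> * \<eta> / 6" "1 \<le> k"
      by (force simp: eventually_sequentially)
    have half: "3 / \<epsilon> * \<rho> k < \<eta> / 2" using k(2) \<epsilon> by (simp add: field_simps)
    define c where "c = 2 * (\<epsilon>/3)\<^sup>2 / (2 * real k)\<^sup>2"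
    have "c > 0" using \<epsilon> k unfolding c_def by simp
    then have "(\<lambda>n. 2 * exp (- (c * real n))) \<longlonglongrightarrow> 2 * 0"
      by real_asymp
    moreover have "hb k = (\<lambda>n. 2 * exp (- (c * real n)))"
      unfolding hb_def c_def by (simp add: mult_ac)
    ultimately have "\<forall>\<^sub>F n in sequentially. hb k n < \<eta> / 2"
      using \<eta> by (intro order_tendstoD(2)[of _ 0]) auto
    then have "\<forall>\<^sub>F n in sequentially. norm (prob {x\<in>space M. \<epsilon> \<le> \<bar>(\<Sum>i=1..n. Y i x) / real n - expectation (Y 1)\<bar>} - 0) < \<eta>"
      using eventually_ge_at_top[of 1]
    proof eventually_elim
      case (elim n)
      then show ?case using bound[OF elim(2) k(3) k(1)] half by simp
    qed
    then show "\<exists>N. \<forall>n\<ge>N. norm (prob {x\<in>space M. \<epsilon> \<le> \<bar>(\<Sum>i=1..n. Y i x) / real n - expectation (Y 1)\<bar>} - 0) < \<eta>"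
      by (simp add: eventually_sequentially)
  qed
qed

section \<open>Integrable majorants on small balls\<close>

text \<open>
  This is what makes the criterion integrable at every parameter; \<open>U\<close> will be the supremum of the
  criterion over a ball. Only the positive part of \<open>U\<close> has to be integrable, because the negative part
  of \<open>h\<close> is bounded and the measure finite.
\<close>

lemma integrable_between_const_and_majorant:
  fixes h :: "'x \<Rightarrow> real" and U :: "'x \<Rightarrow> ereal"
  assumes G: "finite_measure G"
    and h [measurable]: "h \<in> borel_measurable G"
    and lower: "\<And>x. x \<in> space G \<Longrightarrow> - C \<le> h x"
    and upper: "\<And>x. x \<in> space G \<Longrightarrow> ereal (h x) \<le> U x"
    and fin: "(\<integral>\<^sup>+x. e2ennreal (U x) \<partial>G) < \<infinity>"
  shows "integrable G h"
proof (rule integrableI_bounded)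
  interpret finite_measure G by (rule G)
  have "(\<integral>\<^sup>+x. ennreal (norm (h x)) \<partial>G) \<le> (\<integral>\<^sup>+x. ennreal (h x) + ennreal \<bar>C\<bar> \<partial>G)"
  proof (rule nn_integral_mono)
    fix x assume x: "x \<in> space G"
    have "norm (h x) \<le> max 0 (h x) + \<bar>C\<bar>"
      using lower[OF x] by auto
    then have "ennreal (norm (h x)) \<le> ennreal (max 0 (h x) + \<bar>C\<bar>)"
      by (rule ennreal_leI)
    then show "ennreal (norm (h x)) \<le> ennreal (h x) + ennreal \<bar>C\<bar>"
      by (simp add: ennreal_plus max_def ennreal_neg split: if_splits)
  qed
  also have "\<dots> = (\<integral>\<^sup>+x. ennreal (h x) \<partial>G) + (\<integral>\<^sup>+x. ennreal \<bar>C\<bar> \<partial>G)"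
    by (rule nn_integral_add) auto
  also have "(\<integral>\<^sup>+x. ennreal (h x) \<partial>G) \<le> (\<integral>\<^sup>+x. e2ennreal (U x) \<partial>G)"
    using upper by (intro nn_integral_mono) (metis e2ennreal_ereal e2ennreal_mono)
  finally show "(\<integral>\<^sup>+x. ennreal (norm (h x)) \<partial>G) < \<infinity>"
    using fin by (auto simp: ennreal_mult_eq_top_iff less_top[symmetric] top_unique)
qed measurable

text \<open>
  Over the shrinking balls of radius \<open>R n\<close>, the suprema lie between \<open>h x \<theta>\<close> and the supremum over the
  first ball, both of which are integrable, and upper semicontinuity makes them tend to \<open>h x \<theta>\<close>. Dominated
  convergence then brings the integral below \<open>c\<close> for some \<open>n\<close>. The suprema may be infinite on a null
  set; the real-valued majorant \<open>u\<close> is therefore a bound only almost everywhere.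
\<close>

lemma (in Metric_space) ball_majorant_integral_less:
  fixes h :: "'x \<Rightarrow> 'a \<Rightarrow> real" and G :: "'x measure" and \<theta> :: 'a
  defines "U r x \<equiv> (SUP t\<in>mball \<theta> r. ereal (h x t))"
  assumes \<theta>: "\<theta> \<in> M" and \<rho>: "0 < \<rho>"
    and meas: "\<And>r. 0 < r \<Longrightarrow> r < \<rho> \<Longrightarrow> U r \<in> borel_measurable G"
    and fin: "\<And>r. 0 < r \<Longrightarrow> r < \<rho> \<Longrightarrow> (\<integral>\<^sup>+x. e2ennreal (U r x) \<partial>G) < \<infinity>"
    and int: "integrable G (\<lambda>x. h x \<theta>)"
    and usc: "AE x in G. usc_at mtopology (h x) \<theta>"
    and c: "(\<integral>x. h x \<theta> \<partial>G) < c"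
  obtains r u where "0 < r" "integrable G u" "(\<integral>x. u x \<partial>G) < c"
    "AE x in G. \<forall>t\<in>mball \<theta> r. h x t \<le> u x"
proof -
  \<comment> \<open>The shift by 2 keeps every radius strictly below \<open>\<rho>\<close>.\<close>
  define R where "R n = \<rho> / real (n + 2)" for n
  have R: "0 < R n" "R n < \<rho>" for n
    using \<rho> by (auto simp: R_def field_simps add_pos_nonneg)
  have R_mono: "R n \<le> R 0" for n
    unfolding R_def using \<rho> by (intro divide_left_mono) auto
  have R_lim: "R \<longlonglongrightarrow> 0"
    unfolding R_def by (intro LIMSEQ_ignore_initial_segment[of "\<lambda>n. \<rho> / real n" 0 2] lim_const_over_n)
  define u where "u n x = real_of_ereal (U (R n) x)" for n x
  note [measurable] = meas[OF R]
  have u_meas [measurable]: "u n \<in> borel_measurable G" for n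
    unfolding u_def by measurable
  have U_le: "ereal (h x t) \<le> U r x" if "t \<in> mball \<theta> r" for x t r
    unfolding U_def by (rule SUP_upper[OF that])
  have centre: "\<theta> \<in> mball \<theta> (R n)" for n
    using \<theta> R by simp
  have "AE x in G. e2ennreal (U (R 0) x) \<noteq> \<infinity>"
    using fin[OF R, of 0] by (intro nn_integral_noteq_infinite) auto
  then have U_real: "AE x in G. \<forall>n. U (R n) x = ereal (u n x)"
  proof eventually_elim
    case (elim x)
    show ?case
    proof
      fix n
      have "U (R n) x \<le> U (R 0) x"
        unfolding U_def by (intro SUP_subset_mono mball_subset_concentric R_mono order.refl)
      then have "U (R n) x \<noteq> \<infinity>" using elim by auto
      moreover have "U (R n) x \<noteq> - \<infinity>" using U_le[OF centre, of x n] by auto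
      ultimately show "U (R n) x = ereal (u n x)"
        unfolding u_def by (auto simp: ereal_real)
    qed
  qed
  have maj: "AE x in G. \<forall>n. \<forall>t\<in>mball \<theta> (R n). h x t \<le> u n x"
    using U_real
  proof eventually_elim
    case (elim x)
    show ?case
    proof (intro allI ballI)
      fix n t assume "t \<in> mball \<theta> (R n)"
      then show "h x t \<le> u n x" using U_le[of t "R n" x] elim by simp
    qed
  qed
  have sandwich: "AE x in G. \<forall>n. h x \<theta> \<le> u n x \<and> u n x \<le> u 0 x"
    using U_real
  proof eventually_elim
    case (elim x)
    show ?case
    proof (intro allI conjI)
      fix n
      show "h x \<theta> \<le> u n x" using U_le[OF centre, of x n] elim by simp
      have "U (R n) x \<le> U (R 0) x"
        unfolding U_def by (intro SUP_subset_mono mball_subset_concentric R_mono order.refl)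
      then show "u n x \<le> u 0 x" using elim by simp
    qed
  qed
  \<comment> \<open>The supremum can fall below zero only as far as \<open>h x \<theta>\<close> does, which takes care of its negative part.\<close>
  have int0: "integrable G (u 0)"
  proof (rule integrableI_bounded)
    have "(\<integral>\<^sup>+x. ennreal (norm (u 0 x)) \<partial>G) \<le> (\<integral>\<^sup>+x. e2ennreal (U (R 0) x) + ennreal \<bar>h x \<theta>\<bar> \<partial>G)"
    proof (rule nn_integral_mono_AE)
      show "AE x in G. ennreal (norm (u 0 x)) \<le> e2ennreal (U (R 0) x) + ennreal \<bar>h x \<theta>\<bar>"
        using U_real sandwich
      proof eventually_elim
        case (elim x)
        have "norm (u 0 x) \<le> max 0 (u 0 x) + \<bar>h x \<theta>\<bar>"
          using spec[OF elim(2), of 0] by auto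
        then have "ennreal (norm (u 0 x)) \<le> ennreal (max 0 (u 0 x) + \<bar>h x \<theta>\<bar>)"
          by (rule ennreal_leI)
        then show ?case
          using elim(1) by (simp add: ennreal_plus max_def ennreal_neg split: if_splits)
      qed
    qed
    also have "\<dots> = (\<integral>\<^sup>+x. e2ennreal (U (R 0) x) \<partial>G) + (\<integral>\<^sup>+x. ennreal \<bar>h x \<theta>\<bar> \<partial>G)"
      using int by (intro nn_integral_add) auto
    also have "\<dots> < \<infinity>"
      using fin[OF R, of 0] int by (auto simp: integrable_iff_bounded)
    finally show "(\<integral>\<^sup>+x. ennreal (norm (u 0 x)) \<partial>G) < \<infinity>" .
  qed measurable
  have lim: "AE x in G. (\<lambda>n. u n x) \<longlonglongrightarrow> h x \<theta>"
    using U_real sandwich usc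
  proof eventually_elim
    case (elim x)
    show ?case
    proof (rule order_tendstoI)
      fix a assume "a < h x \<theta>"
      then show "\<forall>\<^sub>F n in sequentially. a < u n x"
        using elim(2) by (intro always_eventually) (meson less_le_trans)
    next
      fix a assume "h x \<theta> < a"
      then obtain b where b: "h x \<theta> < b" "b < a" using dense[of "h x \<theta>" a] by auto
      then have "\<exists>V. openin mtopology V \<and> \<theta> \<in> V \<and> (\<forall>t\<in>V. h x t < b)"
        using elim(3) unfolding usc_at_def by simp
      then obtain V where V: "openin mtopology V" "\<theta> \<in> V" "\<forall>t\<in>V. h x t < b" by blast
      then obtain s where s: "0 < s" "mball \<theta> s \<subseteq> V"
        unfolding openin_mtopology by auto
      have "\<forall>\<^sub>F n in sequentially. R n < s"
        using order_tendstoD(2)[OF R_lim s(1)] .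
      then show "\<forall>\<^sub>F n in sequentially. u n x < a"
      proof eventually_elim
        case (elim n)
        have "U (R n) x \<le> ereal b"
          unfolding U_def
        proof (rule SUP_least)
          fix t assume "t \<in> mball \<theta> (R n)"
          then have "t \<in> V" using s(2) elim by auto
          then show "ereal (h x t) \<le> ereal b" using V(3) by (auto intro: less_imp_le)
        qed
        then show ?case using \<open>\<forall>n. U (R n) x = ereal (u n x)\<close> b by simp
      qed
    qed
  qed
  have bound: "AE x in G. norm (u n x) \<le> \<bar>h x \<theta>\<bar> + \<bar>u 0 x\<bar>" for n
    using sandwich
  proof eventually_elim
    case (elim x)
    then have "h x \<theta> \<le> u n x" "u n x \<le> u 0 x" by auto
    then show ?case by simp
  qed
  have w: "integrable G (\<lambda>x. \<bar>h x \<theta>\<bar> + \<bar>u 0 x\<bar>)"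
    using int int0 by auto
  have h_meas: "(\<lambda>x. h x \<theta>) \<in> borel_measurable G"
    using int by auto
  have "(\<lambda>n. \<integral>x. u n x \<partial>G) \<longlonglongrightarrow> (\<integral>x. h x \<theta> \<partial>G)"
    by (rule integral_dominated_convergence[OF h_meas u_meas w lim bound])
  then have "\<forall>\<^sub>F n in sequentially. (\<integral>x. u n x \<partial>G) < c"
    using c by (rule order_tendstoD(2))
  then obtain n where n: "(\<integral>x. u n x \<partial>G) < c"
    by (auto simp: eventually_sequentially)
  have "integrable G (u n)"
    by (rule Bochner_Integration.integrable_bound[OF w u_meas]) (use bound[of n] in auto)
  moreover have "AE x in G. \<forall>t\<in>mball \<theta> (R n). h x t \<le> u n x"
    using maj by eventually_elim blast
  ultimately show ?thesis using that R(1) n by blast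
qed

section \<open>Approximate maximizers of a sample mean\<close>

lemma (in prob_space) iid_fromD:
  assumes "iid_from M G X" "1 \<le> i"
  shows iid_from_measurable: "X i \<in> measurable M G"
    and iid_from_distr: "distr M G (X i) = G"
  using assms unfolding iid_from_def indep_vars_def by auto

lemma (in prob_space) iid_from_AE:
  assumes iid: "iid_from M G X" and AE: "AE x in G. Q x"
  shows "AE \<omega> in M. \<forall>i\<ge>1. Q (X i \<omega>)"
proof -
  have "AE \<omega> in M. 1 \<le> i \<longrightarrow> Q (X i \<omega>)" for i
  proof (cases "1 \<le> i")
    case True
    have "AE x in distr M G (X i). Q x"
      unfolding iid_from_distr[OF iid True] by (rule AE)
    then show ?thesis
      using AE_distrD[OF iid_from_measurable[OF iid True]] by auto
  qed auto
  then show ?thesis by (simp add: AE_all_countable)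
qed

text \<open>
  With \<open>-2 * \<delta>\<close> for the expectation of \<open>v\<close>, a sample mean above \<open>- R n\<close> either exceeds \<open>- \<delta>\<close>, which is
  a deviation by \<open>\<delta>\<close>, or comes with \<open>R n > \<delta>\<close>. Both become improbable.
\<close>

lemma (in prob_space) sample_mean_nonneg_improbable:
  fixes v :: "'x \<Rightarrow> real"
  assumes iid: "iid_from M G X"
    and int: "integrable G v" and neg: "(\<integral>x. v x \<partial>G) < 0"
    and R: "little_op_1 M R"
  shows "(\<lambda>n. prob {\<omega>\<in>space M. - R n \<omega> \<le> (\<Sum>i=1..n. v (X i \<omega>)) / real n}) \<longlonglongrightarrow> 0"
proof -
  define \<delta> where "\<delta> = - (\<integral>x. v x \<partial>G) / 2"
  have \<delta>: "0 < \<delta>" using neg by (simp add: \<delta>_def)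
  note X = iid_from_measurable[OF iid] iid_from_distr[OF iid]
  have v [measurable]: "v \<in> borel_measurable G" using int by auto
  have vX [measurable]: "(\<lambda>\<omega>. v (X i \<omega>)) \<in> borel_measurable M" if "1 \<le> i" for i
    using X(1)[OF that] by measurable
  have R_meas [measurable]: "R n \<in> borel_measurable M" for n
    using R unfolding little_op_1_def by auto
  have mean: "expectation (\<lambda>\<omega>. v (X 1 \<omega>)) = - 2 * \<delta>"
    using integral_distr[OF X(1)[OF order.refl] v] X(2)[OF order.refl] by (simp add: \<delta>_def)
  have law: "(\<lambda>n. prob {\<omega>\<in>space M. \<delta> \<le> \<bar>(\<Sum>i=1..n. v (X i \<omega>)) / real n
      - expectation (\<lambda>\<omega>. v (X 1 \<omega>))\<bar>}) \<longlonglongrightarrow> 0"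
  proof (rule weak_law_of_large_numbers)
    show "indep_vars (\<lambda>_. borel) (\<lambda>i \<omega>. v (X i \<omega>)) {1..}"
      by (rule indep_vars_compose2[where M' = "\<lambda>_. G" and X = X])
        (use iid in \<open>auto simp: iid_from_def\<close>)
    show "distr M borel (\<lambda>\<omega>. v (X i \<omega>)) = distr M borel (\<lambda>\<omega>. v (X 1 \<omega>))" if "1 \<le> i" for i
      using distr_distr[OF v X(1)[OF that], unfolded X(2)[OF that] o_def]
        distr_distr[OF v X(1)[OF order.refl], unfolded X(2)[OF order.refl] o_def] by simp
    show "integrable M (\<lambda>\<omega>. v (X 1 \<omega>))"
      using integrable_distr_eq[OF X(1)[OF order.refl] v] X(2)[OF order.refl] int by simp
  qed (rule \<delta>)
  have rem: "(\<lambda>n. prob {\<omega>\<in>space M. \<delta> < \<bar>R n \<omega>\<bar>}) \<longlonglongrightarrow> 0"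
    using R \<delta> unfolding little_op_1_def by auto
  show ?thesis
  proof (rule tendsto_sandwich[OF always_eventually always_eventually tendsto_const])
    show "\<forall>n. 0 \<le> prob {\<omega>\<in>space M. - R n \<omega> \<le> (\<Sum>i=1..n. v (X i \<omega>)) / real n}"
      by (intro allI measure_nonneg)
    show "(\<lambda>n. prob {\<omega>\<in>space M. \<delta> \<le> \<bar>(\<Sum>i=1..n. v (X i \<omega>)) / real n
        - expectation (\<lambda>\<omega>. v (X 1 \<omega>))\<bar>} + prob {\<omega>\<in>space M. \<delta> < \<bar>R n \<omega>\<bar>}) \<longlonglongrightarrow> 0"
      using tendsto_add[OF law rem] by simp
    show "\<forall>n. prob {\<omega>\<in>space M. - R n \<omega> \<le> (\<Sum>i=1..n. v (X i \<omega>)) / real n}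
        \<le> prob {\<omega>\<in>space M. \<delta> \<le> \<bar>(\<Sum>i=1..n. v (X i \<omega>)) / real n
            - expectation (\<lambda>\<omega>. v (X 1 \<omega>))\<bar>} + prob {\<omega>\<in>space M. \<delta> < \<bar>R n \<omega>\<bar>}"
    proof
      fix n
      have "{\<omega>\<in>space M. - R n \<omega> \<le> (\<Sum>i=1..n. v (X i \<omega>)) / real n}
        \<subseteq> {\<omega>\<in>space M. \<delta> \<le> \<bar>(\<Sum>i=1..n. v (X i \<omega>)) / real n - expectation (\<lambda>\<omega>. v (X 1 \<omega>))\<bar>}
          \<union> {\<omega>\<in>space M. \<delta> < \<bar>R n \<omega>\<bar>}"
        unfolding mean by auto
      then have "prob {\<omega>\<in>space M. - R n \<omega> \<le> (\<Sum>i=1..n. v (X i \<omega>)) / real n}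
        \<le> prob ({\<omega>\<in>space M. \<delta> \<le> \<bar>(\<Sum>i=1..n. v (X i \<omega>)) / real n - expectation (\<lambda>\<omega>. v (X 1 \<omega>))\<bar>}
          \<union> {\<omega>\<in>space M. \<delta> < \<bar>R n \<omega>\<bar>})"
        by (rule finite_measure_mono) measurable
      also have "\<dots> \<le> prob {\<omega>\<in>space M. \<delta> \<le> \<bar>(\<Sum>i=1..n. v (X i \<omega>)) / real n
            - expectation (\<lambda>\<omega>. v (X 1 \<omega>))\<bar>} + prob {\<omega>\<in>space M. \<delta> < \<bar>R n \<omega>\<bar>}"
        by (intro measure_Un_le) measurable
      finally show "prob {\<omega>\<in>space M. - R n \<omega> \<le> (\<Sum>i=1..n. v (X i \<omega>)) / real n}
        \<le> prob {\<omega>\<in>space M. \<delta> \<le> \<bar>(\<Sum>i=1..n. v (X i \<omega>)) / real n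
            - expectation (\<lambda>\<omega>. v (X 1 \<omega>))\<bar>} + prob {\<omega>\<in>space M. \<delta> < \<bar>R n \<omega>\<bar>}" .
    qed
  qed
qed

text \<open>
  Wald's covering argument, for an arbitrary criterion \<open>h\<close>. If \<open>T n\<close> lies in a member \<open>V \<theta>\<close> of the
  finite subcover, then the sample mean of \<open>u \<theta>\<close> dominates that of \<open>h\<close> at \<open>T n\<close>, hence also that of
  \<open>h\<close> at \<open>\<psi>\<close> up to \<open>R n\<close>. This confines \<open>T n \<in> K\<close> to the finite union of the improbable events \<open>B\<close>.
\<close>

lemma (in prob_space) approx_maximizer_avoids_compact:
  fixes h :: "'x \<Rightarrow> 'p \<Rightarrow> real" and T :: "nat \<Rightarrow> 'a \<Rightarrow> 'p"
  assumes iid: "iid_from M G X"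
    and K: "compactin \<tau> K"
    and loc: "\<And>\<theta>. \<theta> \<in> K \<Longrightarrow> \<exists>V u. openin \<tau> V \<and> \<theta> \<in> V \<and> integrable G u
        \<and> (\<integral>x. u x \<partial>G) < (\<integral>x. h x \<psi> \<partial>G) \<and> (AE x in G. \<forall>t\<in>V. h x t \<le> u x)"
    and int0: "integrable G (\<lambda>x. h x \<psi>)"
    and R: "little_op_1 M R"
    and max: "\<And>n. 1 \<le> n \<Longrightarrow> AE \<omega> in M.
        (\<Sum>i=1..n. h (X i \<omega>) \<psi>) / real n - R n \<omega> \<le> (\<Sum>i=1..n. h (X i \<omega>) (T n \<omega>)) / real n"
  shows "(\<lambda>n. prob {\<omega>\<in>space M. T n \<omega> \<in> K}) \<longlonglongrightarrow> 0"
proof -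
  have "\<forall>\<theta>\<in>K. \<exists>V u. openin \<tau> V \<and> \<theta> \<in> V \<and> integrable G u
      \<and> (\<integral>x. u x \<partial>G) < (\<integral>x. h x \<psi> \<partial>G) \<and> (AE x in G. \<forall>t\<in>V. h x t \<le> u x)"
    by (intro ballI loc)
  from bchoice[OF this] obtain V where "\<forall>\<theta>\<in>K. \<exists>u. openin \<tau> (V \<theta>) \<and> \<theta> \<in> V \<theta> \<and> integrable G u
      \<and> (\<integral>x. u x \<partial>G) < (\<integral>x. h x \<psi> \<partial>G) \<and> (AE x in G. \<forall>t\<in>V \<theta>. h x t \<le> u x)" ..
  from bchoice[OF this] obtain u where Vu: "\<forall>\<theta>\<in>K. openin \<tau> (V \<theta>) \<and> \<theta> \<in> V \<theta> \<and> integrable G (u \<theta>)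
      \<and> (\<integral>x. u \<theta> x \<partial>G) < (\<integral>x. h x \<psi> \<partial>G) \<and> (AE x in G. \<forall>t\<in>V \<theta>. h x t \<le> u \<theta> x)" ..
  then have V: "\<And>\<theta>. \<theta> \<in> K \<Longrightarrow> openin \<tau> (V \<theta>)" "\<And>\<theta>. \<theta> \<in> K \<Longrightarrow> \<theta> \<in> V \<theta>"
    and u: "\<And>\<theta>. \<theta> \<in> K \<Longrightarrow> integrable G (u \<theta>)"
      "\<And>\<theta>. \<theta> \<in> K \<Longrightarrow> (\<integral>x. u \<theta> x \<partial>G) < (\<integral>x. h x \<psi> \<partial>G)"
      "\<And>\<theta>. \<theta> \<in> K \<Longrightarrow> AE x in G. \<forall>t\<in>V \<theta>. h x t \<le> u \<theta> x"
    by blast+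
  have "\<exists>\<F>. finite \<F> \<and> \<F> \<subseteq> V ` K \<and> K \<subseteq> \<Union>\<F>"
    by (rule compactinD[OF K]) (use V in auto)
  then obtain \<F> where \<F>: "finite \<F>" "\<F> \<subseteq> V ` K" "K \<subseteq> \<Union>\<F>" by blast
  obtain F where F: "finite F" "F \<subseteq> K" "K \<subseteq> (\<Union>\<theta>\<in>F. V \<theta>)"
    using finite_subset_image[OF \<F>(1,2)] \<F>(3) by blast
  define B where "B \<theta> n = {\<omega>\<in>space M. - R n \<omega> \<le> (\<Sum>i=1..n. u \<theta> (X i \<omega>) - h (X i \<omega>) \<psi>) / real n}"
    for \<theta> n
  have B_lim: "(\<lambda>n. prob (B \<theta> n)) \<longlonglongrightarrow> 0" if "\<theta> \<in> F" for \<theta>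
    unfolding B_def
    by (rule sample_mean_nonneg_improbable[OF iid _ _ R]) (use u F that int0 in auto)
  have R_meas [measurable]: "R n \<in> borel_measurable M" for n
    using R unfolding little_op_1_def by auto
  have B_sets: "B \<theta> n \<in> sets M" if "\<theta> \<in> F" for \<theta> n
  proof -
    have v: "(\<lambda>x. u \<theta> x - h x \<psi>) \<in> borel_measurable G"
      using u(1)[of \<theta>] F(2) that int0 by auto
    have [measurable]: "(\<lambda>\<omega>. u \<theta> (X i \<omega>) - h (X i \<omega>) \<psi>) \<in> borel_measurable M" if "i \<in> {1..n}" for i
      using measurable_compose[OF iid_from_measurable[OF iid] v] that by auto
    show ?thesis unfolding B_def by measurable
  qed
  have le: "prob {\<omega>\<in>space M. T n \<omega> \<in> K} \<le> (\<Sum>\<theta>\<in>F. prob (B \<theta> n))" if n: "1 \<le> n" for n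
  proof -
    have "AE \<omega> in M. \<forall>\<theta>\<in>F. \<forall>i\<ge>1. \<forall>t\<in>V \<theta>. h (X i \<omega>) t \<le> u \<theta> (X i \<omega>)"
    proof (rule AE_finite_allI[OF F(1)], rule iid_from_AE[OF iid])
      show "AE x in G. \<forall>t\<in>V \<theta>. h x t \<le> u \<theta> x" if "\<theta> \<in> F" for \<theta>
        using u(3) F(2) that by blast
    qed
    then have "AE \<omega> in M. \<omega> \<in> {\<omega>\<in>space M. T n \<omega> \<in> K} \<longrightarrow> \<omega> \<in> (\<Union>\<theta>\<in>F. B \<theta> n)"
      using max[OF n]
    proof eventually_elim
      case (elim \<omega>)
      show ?case
      proof
        assume \<omega>: "\<omega> \<in> {\<omega>\<in>space M. T n \<omega> \<in> K}"
        then obtain \<theta> where \<theta>: "\<theta> \<in> F" "T n \<omega> \<in> V \<theta>" using F(3) by auto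
        have "(\<Sum>i=1..n. h (X i \<omega>) (T n \<omega>)) / real n \<le> (\<Sum>i=1..n. u \<theta> (X i \<omega>)) / real n"
          using elim(1) \<theta> by (intro divide_right_mono sum_mono) auto
        then have "- R n \<omega> \<le> (\<Sum>i=1..n. u \<theta> (X i \<omega>) - h (X i \<omega>) \<psi>) / real n"
          using elim(2) by (simp add: sum_subtractf diff_divide_distrib)
        then show "\<omega> \<in> (\<Union>\<theta>\<in>F. B \<theta> n)" using \<theta> \<omega> unfolding B_def by auto
      qed
    qed
    \<comment> \<open>The left event may fail to be measurable; \<open>prob\<close> is then \<open>0\<close> by convention.\<close>
    then have "prob {\<omega>\<in>space M. T n \<omega> \<in> K} \<le> prob (\<Union>\<theta>\<in>F. B \<theta> n)"
      using F(1) B_sets by (intro finite_measure_mono_AE) auto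
    also have "\<dots> \<le> (\<Sum>\<theta>\<in>F. prob (B \<theta> n))"
      using F(1) B_sets by (intro finite_measure_subadditive_finite) auto
    finally show ?thesis .
  qed
  show ?thesis
  proof (rule tendsto_sandwich[OF _ _ tendsto_const])
    show "\<forall>\<^sub>F n in sequentially. prob {\<omega>\<in>space M. T n \<omega> \<in> K} \<le> (\<Sum>\<theta>\<in>F. prob (B \<theta> n))"
      using eventually_ge_at_top[of 1] by eventually_elim (rule le)
    show "\<forall>\<^sub>F n in sequentially. 0 \<le> prob {\<omega>\<in>space M. T n \<omega> \<in> K}"
      by (intro always_eventually allI measure_nonneg)
    show "(\<lambda>n. \<Sum>\<theta>\<in>F. prob (B \<theta> n)) \<longlonglongrightarrow> 0"
      using tendsto_sum[of F "\<lambda>\<theta> n. prob (B \<theta> n)" "\<lambda>_. 0"] B_lim by simp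
  qed
qed

section \<open>The density power divergence criterion\<close>

lemma prob_density_onD:
  assumes "prob_density_on \<X> g"
  shows "g \<in> borel_measurable (lborel_on \<X>)" "AE x in lborel_on \<X>. 0 \<le> g x"
  using assms unfolding prob_density_on_def by (auto simp: lborel_on_def space_restrict_space)

lemma borel_measurable_distribution_of [simp]:
  "borel_measurable (distribution_of \<X> g) = borel_measurable (lborel_on \<X>)"
  by (simp add: distribution_of_def cong: measurable_cong_sets)

lemma finite_measure_distribution_of:
  assumes "prob_density_on \<X> g"
  shows "finite_measure (distribution_of \<X> g)"
proof (rule finite_measureI)
  have "emeasure (distribution_of \<X> g) (space (distribution_of \<X> g)) = 1"
    using assms prob_density_onD(1)[OF assms] unfolding distribution_of_def prob_density_on_def
    by (simp add: emeasure_density cong: nn_integral_cong)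
  then show "emeasure (distribution_of \<X> g) (space (distribution_of \<X> g)) \<noteq> \<infinity>"
    by simp
qed

lemma e2ennreal_mult_ereal:
  assumes "0 \<le> c"
  shows "e2ennreal (x * ereal c) = ennreal c * e2ennreal x"
proof (cases x)
  case (real r)
  then show ?thesis
    using assms by (cases "0 \<le> r") (auto simp: ennreal_mult' mult.commute ennreal_neg mult_nonneg_nonpos)
next
  case PInf
  show ?thesis
  proof (cases "c = 0")
    case True
    then show ?thesis by (simp add: zero_ereal_def[symmetric] e2ennreal_neg)
  next
    case False
    then show ?thesis using PInf assms by (simp add: ennreal_mult_top)
  qed
next
  case MInf
  then show ?thesis
    using assms by (cases "c = 0") (auto simp: zero_ereal_def[symmetric] e2ennreal_neg)
qed

text \<open>
  If the positive part had infinite integral, the value would be \<open>\<infinity>\<close> even when the negative part is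
  infinite as well, because \<open>\<infinity> - \<infinity> = \<infinity>\<close> in \<open>ereal\<close>.
\<close>

lemma ereal_integral_lt_top_imp_positive_part:
  assumes "ereal_integral M h < \<infinity>"
  shows "(\<integral>\<^sup>+x. e2ennreal (h x) \<partial>M) < \<infinity>"
proof (rule ccontr)
  assume "\<not> (\<integral>\<^sup>+x. e2ennreal (h x) \<partial>M) < \<infinity>"
  then have "(\<integral>\<^sup>+x. e2ennreal (h x) \<partial>M) = top"
    by (simp add: less_top[symmetric])
  then have "ereal_integral M h = \<infinity>"
    unfolding ereal_integral_def by simp
  with assms show False by simp
qed

text \<open>
  The small-ball condition is an \<open>ereal\<close> integral against Lebesgue measure with weight \<open>g\<close>. Its content
  for the distribution of the observations is that the positive part of the supremum is integrable.
\<close>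

lemma nn_integral_distribution_of_less_top:
  fixes U :: "'x::euclidean_space \<Rightarrow> ereal"
  assumes g: "prob_density_on \<X> g"
    and U: "U \<in> borel_measurable (lborel_on \<X>)"
    and fin: "ereal_integral (lborel_on \<X>) (\<lambda>x. U x * ereal (g x)) < \<infinity>"
  shows "(\<integral>\<^sup>+x. e2ennreal (U x) \<partial>distribution_of \<X> g) < \<infinity>"
proof -
  have "(\<integral>\<^sup>+x. e2ennreal (U x) \<partial>distribution_of \<X> g)
      = (\<integral>\<^sup>+x. ennreal (g x) * e2ennreal (U x) \<partial>lborel_on \<X>)"
    unfolding distribution_of_def using U prob_density_onD(1)[OF g]
    by (intro nn_integral_density) auto
  also have "\<dots> = (\<integral>\<^sup>+x. e2ennreal (U x * ereal (g x)) \<partial>lborel_on \<X>)"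
    using prob_density_onD(2)[OF g] by (intro nn_integral_cong_AE) (auto simp: e2ennreal_mult_ereal)
  also have "\<dots> < \<infinity>"
    by (rule ereal_integral_lt_top_imp_positive_part[OF fin])
  finally show ?thesis .
qed

lemma dpd_m_measurable:
  assumes "prob_density_on \<X> (\<lambda>x. f x \<theta>)"
  shows "(\<lambda>x. dpd_m \<alpha> \<X> f x \<theta>) \<in> borel_measurable (lborel_on \<X>)"
  unfolding dpd_m_def using prob_density_onD(1)[OF assms] by measurable

text \<open>
  The bound is uniform in \<open>x\<close>: the criterion is a nonnegative power minus an integral that depends on
  the parameter only.
\<close>

lemma dpd_m_ge:
  assumes "0 < \<alpha>"
  shows "- (\<integral>y. f y \<theta> powr (1 + \<alpha>) \<partial>lborel_on \<X>) \<le> dpd_m \<alpha> \<X> f x \<theta>"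
  unfolding dpd_m_def using assms by simp

lemma dpd_M_eq_integral:
  assumes g: "prob_density_on \<X> g"
    and \<theta>: "\<theta> \<in> \<Theta>"
    and int: "integrable (distribution_of \<X> g) (\<lambda>x. dpd_m \<alpha> \<X> f x \<theta>)"
  shows "\<theta> \<in> Theta_G \<alpha> \<X> \<Theta> f g"
    and "dpd_M \<alpha> \<X> \<Theta> f g \<theta> = ereal (\<integral>x. dpd_m \<alpha> \<X> f x \<theta> \<partial>distribution_of \<X> g)"
proof -
  note gD = prob_density_onD[OF g]
  have meas: "(\<lambda>x. dpd_m \<alpha> \<X> f x \<theta>) \<in> borel_measurable (lborel_on \<X>)"
    using borel_measurable_integrable[OF int] by simp
  have "integrable (lborel_on \<X>) (\<lambda>x. g x *\<^sub>R dpd_m \<alpha> \<X> f x \<theta>)"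
    using int integrable_density[OF meas gD] unfolding distribution_of_def by simp
  then have "(\<integral>\<^sup>+x. ennreal (norm (g x *\<^sub>R dpd_m \<alpha> \<X> f x \<theta>)) \<partial>lborel_on \<X>) < \<infinity>"
    unfolding integrable_iff_bounded by simp
  also have "(\<integral>\<^sup>+x. ennreal (norm (g x *\<^sub>R dpd_m \<alpha> \<X> f x \<theta>)) \<partial>lborel_on \<X>)
      = (\<integral>\<^sup>+x. ennreal (\<bar>dpd_m \<alpha> \<X> f x \<theta>\<bar> * g x) \<partial>lborel_on \<X>)"
    using gD(2) by (intro nn_integral_cong_AE) (auto simp: abs_mult mult.commute)
  finally show "\<theta> \<in> Theta_G \<alpha> \<X> \<Theta> f g"
    using \<theta> unfolding Theta_G_def by simp
  then show "dpd_M \<alpha> \<X> \<Theta> f g \<theta> = ereal (\<integral>x. dpd_m \<alpha> \<X> f x \<theta> \<partial>distribution_of \<X> g)"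
    using integral_density[OF meas gD] unfolding dpd_M_def distribution_of_def
    by (simp add: mult.commute)
qed

section \<open>Consistency\<close>

theorem theorem1:
  fixes \<alpha> :: real
    and \<X> :: "'x::euclidean_space set" and g :: "'x \<Rightarrow> real"
    and \<Theta> :: "(real ^ 'p) set" and d :: "real ^ 'p \<Rightarrow> real ^ 'p \<Rightarrow> real"
    and f :: "'x \<Rightarrow> real ^ 'p \<Rightarrow> real" and \<theta>0 :: "real ^ 'p"
    and P :: "'w measure" and X :: "nat \<Rightarrow> 'w \<Rightarrow> 'x"
    and \<theta>hat :: "nat \<Rightarrow> 'w \<Rightarrow> real ^ 'p" and R :: "nat \<Rightarrow> 'w \<Rightarrow> real"
    and K :: "(real ^ 'p) set" and \<epsilon> :: real
  assumes alpha: "0 < \<alpha>"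
    and sample_space: "\<X> \<in> sets borel"
    and density_g: "prob_density_on \<X> g"
    and support_g: "has_support g \<X>"
    and prob: "prob_space P"
    and iid: "iid_from P (distribution_of \<X> g) X"
    and family: "\<forall>\<theta>\<in>\<Theta>. prob_density_on \<X> (\<lambda>x. f x \<theta>)"
    and ident: "identifiable \<X> \<Theta> f"
    and m_real_valued: "\<forall>\<theta>\<in>\<Theta>. integrable (lborel_on \<X>) (\<lambda>y. f y \<theta> powr (1 + \<alpha>))"
    and metric: "Metric_space \<Theta> d"
    and compact: "compact_space (Metric_space.mtopology \<Theta> d)"
    and nontrivial: "\<exists>\<theta>\<in>Theta_G \<alpha> \<X> \<Theta> f g. \<theta> \<noteq> \<theta>0"
    and target_in: "\<theta>0 \<in> \<Theta>"
    and target_finite: "-\<infinity> < dpd_M \<alpha> \<X> \<Theta> f g \<theta>0" "dpd_M \<alpha> \<X> \<Theta> f g \<theta>0 < \<infinity>"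
    and target_max: "dpd_M \<alpha> \<X> \<Theta> f g \<theta>0 = (SUP \<theta>\<in>\<Theta>. dpd_M \<alpha> \<X> \<Theta> f g \<theta>)"
    and target_unique:
      "\<forall>\<theta>\<in>\<Theta>. dpd_M \<alpha> \<X> \<Theta> f g \<theta> = (SUP \<theta>'\<in>\<Theta>. dpd_M \<alpha> \<X> \<Theta> f g \<theta>') \<longrightarrow> \<theta> = \<theta>0"
    and usc:
      "\<forall>\<theta>\<in>Theta_G \<alpha> \<X> \<Theta> f g. AE x in distribution_of \<X> g.
         usc_at (Metric_space.mtopology \<Theta> d) (\<lambda>\<theta>'. dpd_m \<alpha> \<X> f x \<theta>') \<theta>"
    and small_balls:
      "\<exists>\<rho>>0. \<forall>\<theta>\<in>\<Theta>. \<forall>r. 0 < r \<and> r < \<rho> \<longrightarrow>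
         (\<lambda>x. SUP \<theta>'\<in>Metric_space.mball \<Theta> d \<theta> r. ereal (dpd_m \<alpha> \<X> f x \<theta>'))
           \<in> borel_measurable (lborel_on \<X>) \<and>
         ereal_integral (lborel_on \<X>)
           (\<lambda>x. (SUP \<theta>'\<in>Metric_space.mball \<Theta> d \<theta> r. ereal (dpd_m \<alpha> \<X> f x \<theta>')) * ereal (g x)) < \<infinity>"
    and estimator:
      "\<forall>n\<ge>1. estimator_based_on P (distribution_of \<X> g) (borel_of_metric \<Theta> d) X n (\<theta>hat n)"
    and remainder: "little_op_1 P R"
    and approx_max:
      "\<forall>n\<ge>1. AE \<omega> in P. dpd_mn \<alpha> \<X> f X n (\<theta>hat n \<omega>) \<omega> \<ge> dpd_mn \<alpha> \<X> f X n \<theta>0 \<omega> - R n \<omega>"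
    and eps: "0 < \<epsilon>"
    and K: "compactin (Metric_space.mtopology \<Theta> d) K"
  shows "(\<lambda>n. measure P {\<omega>\<in>space P. \<epsilon> \<le> d (\<theta>hat n \<omega>) \<theta>0 \<and> \<theta>hat n \<omega> \<in> K}) \<longlonglongrightarrow> 0"
proof -
  define G where "G = distribution_of \<X> g"
  define m where "m x \<theta> = dpd_m \<alpha> \<X> f x \<theta>" for x \<theta>
  interpret Metric_space \<Theta> d by (rule metric)
  interpret prob_space P by (rule prob)
  have G_finite: "finite_measure G"
    unfolding G_def by (rule finite_measure_distribution_of[OF density_g])
  obtain \<rho> where \<rho>: "0 < \<rho>" and balls: "\<forall>\<theta>\<in>\<Theta>. \<forall>r. 0 < r \<and> r < \<rho> \<longrightarrow>
      (\<lambda>x. SUP t\<in>mball \<theta> r. ereal (m x t)) \<in> borel_measurable (lborel_on \<X>) \<and>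
      ereal_integral (lborel_on \<X>) (\<lambda>x. (SUP t\<in>mball \<theta> r. ereal (m x t)) * ereal (g x)) < \<infinity>"
    using small_balls unfolding m_def by blast
  have sup_meas: "(\<lambda>x. SUP t\<in>mball \<theta> r. ereal (m x t)) \<in> borel_measurable G"
    and sup_fin: "(\<integral>\<^sup>+x. e2ennreal (SUP t\<in>mball \<theta> r. ereal (m x t)) \<partial>G) < \<infinity>"
    if "\<theta> \<in> \<Theta>" "0 < r" "r < \<rho>" for \<theta> r
    using balls that nn_integral_distribution_of_less_top[OF density_g] unfolding G_def by auto
  \<comment> \<open>The radius \<open>\<rho> / 2\<close> is just one for which the small-ball condition holds.\<close>
  have int: "integrable G (\<lambda>x. m x \<theta>)" if \<theta>: "\<theta> \<in> \<Theta>" for \<theta>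
  proof (rule integrable_between_const_and_majorant[OF G_finite])
    show "(\<lambda>x. m x \<theta>) \<in> borel_measurable G"
      unfolding m_def G_def using family \<theta> by (simp add: dpd_m_measurable)
    show "- (\<integral>y. f y \<theta> powr (1 + \<alpha>) \<partial>lborel_on \<X>) \<le> m x \<theta>" for x
      unfolding m_def by (rule dpd_m_ge[OF alpha])
    show "ereal (m x \<theta>) \<le> (SUP t\<in>mball \<theta> (\<rho> / 2). ereal (m x t))" for x
      using \<theta> \<rho> by (intro SUP_upper) simp
    show "(\<integral>\<^sup>+x. e2ennreal (SUP t\<in>mball \<theta> (\<rho> / 2). ereal (m x t)) \<partial>G) < \<infinity>"
      using sup_fin[OF \<theta>] \<rho> by simp
  qed
  have \<Theta>_G: "\<theta> \<in> Theta_G \<alpha> \<X> \<Theta> f g"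
    and M_eq: "dpd_M \<alpha> \<X> \<Theta> f g \<theta> = ereal (\<integral>x. m x \<theta> \<partial>G)" if "\<theta> \<in> \<Theta>" for \<theta>
    using dpd_M_eq_integral[OF density_g that] int[OF that] unfolding G_def m_def by auto
  have strict: "(\<integral>x. m x \<theta> \<partial>G) < (\<integral>x. m x \<theta>0 \<partial>G)" if \<theta>: "\<theta> \<in> \<Theta>" "\<theta> \<noteq> \<theta>0" for \<theta>
  proof -
    have "dpd_M \<alpha> \<X> \<Theta> f g \<theta> \<noteq> dpd_M \<alpha> \<X> \<Theta> f g \<theta>0"
      using target_unique target_max \<theta> by auto
    moreover have "dpd_M \<alpha> \<X> \<Theta> f g \<theta> \<le> dpd_M \<alpha> \<X> \<Theta> f g \<theta>0"
      unfolding target_max by (rule SUP_upper[OF \<theta>(1)])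
    ultimately show ?thesis using M_eq[OF \<theta>(1)] M_eq[OF target_in] by simp
  qed
  \<comment> \<open>The part of \<open>K\<close> that the estimators have to avoid; it is compact and does not contain \<open>\<theta>0\<close>.\<close>
  define L where "L = K \<inter> (\<Theta> - mball \<theta>0 \<epsilon>)"
  have L: "compactin mtopology L"
    unfolding L_def by (intro compact_Int_closedin K) (metis closedin_diff closedin_topspace openin_mball topspace_mtopology)
  have K_sub: "K \<subseteq> \<Theta>"
    using compactin_subset_topspace[OF K] by simp
  have "(\<lambda>n. prob {\<omega>\<in>space P. \<theta>hat n \<omega> \<in> L}) \<longlonglongrightarrow> 0"
  proof (rule approx_maximizer_avoids_compact[where h = m and \<psi> = \<theta>0])
    show "iid_from P G X" unfolding G_def by (rule iid)
    show "compactin mtopology L" by (rule L)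
    show "integrable G (\<lambda>x. m x \<theta>0)" by (rule int[OF target_in])
    show "little_op_1 P R" by (rule remainder)
    show "AE \<omega> in P. (\<Sum>i=1..n. m (X i \<omega>) \<theta>0) / real n - R n \<omega>
        \<le> (\<Sum>i=1..n. m (X i \<omega>) (\<theta>hat n \<omega>)) / real n" if "1 \<le> n" for n
      using approx_max that unfolding dpd_mn_def m_def by simp
    fix \<theta> assume "\<theta> \<in> L"
    then have \<theta>: "\<theta> \<in> \<Theta>" "\<theta> \<noteq> \<theta>0"
      using eps target_in unfolding L_def by auto
    have "AE x in G. usc_at mtopology (m x) \<theta>"
      using usc \<Theta>_G[OF \<theta>(1)] unfolding G_def m_def by blast
    from ball_majorant_integral_less[OF \<theta>(1) \<rho> sup_meas[OF \<theta>(1)] sup_fin[OF \<theta>(1)]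
        int[OF \<theta>(1)] this strict[OF \<theta>]]
    obtain r u where "0 < r" "integrable G u" "(\<integral>x. u x \<partial>G) < (\<integral>x. m x \<theta>0 \<partial>G)"
      "AE x in G. \<forall>t\<in>mball \<theta> r. m x t \<le> u x" .
    then show "\<exists>V u. openin mtopology V \<and> \<theta> \<in> V \<and> integrable G u
        \<and> (\<integral>x. u x \<partial>G) < (\<integral>x. m x \<theta>0 \<partial>G) \<and> (AE x in G. \<forall>t\<in>V. m x t \<le> u x)"
      using \<theta>(1) by (intro exI[of _ "mball \<theta> r"] exI[of _ u]) auto
  qed
  moreover have "{\<omega>\<in>space P. \<epsilon> \<le> d (\<theta>hat n \<omega>) \<theta>0 \<and> \<theta>hat n \<omega> \<in> K}
      = {\<omega>\<in>space P. \<theta>hat n \<omega> \<in> L}" for n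
    using K_sub target_in unfolding L_def by (auto simp: commute)
  ultimately show ?thesis by simp
qed

end
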